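(* Let $F(\cdot;\theta)$, $\theta\in\Theta$, be an exponential family of the first type with functions $A$ and $B$. Suppose a random sample of size $n$ from $F(\cdot;\theta)$ is available and that it includes $m$ upper record values $R_1,\dots,R_m$. Then the estimators $\hat\theta_{MLE,(R_1,\dots,R_m)}=B^{-1}\!\left(\frac{m}{A(R_m)}\right)$ are consistent for $\theta$; namely, as $m\to\infty$, $$\hat\theta_{MLE,(R_1,\dots,R_m)}\xrightarrow{P}\theta,$$ where $\xrightarrow{P}$ denotes convergence in probability under the true parameter $\theta$.
   Context: Exponential family of the first type: the family of distributions with cumulative distribution function $F(x;\theta)=1-\exp\{-B(\theta)A(x)\}$ for $x\in[a,b]$, where $A$ is an increasing differentiable function with $A(a)=0$, $A(b)=+\infty$ ($b=+\infty$ is allowed), and $B(\theta)>0$. The density is $f(x;\theta)=A'(x)B(\theta)\exp\{-A(x)B(\theta)\}$. The parameter set $\Theta\subseteq\mathbb{R}$ is an interval, $B:\Theta\to\mathbb{R}$ is twice differentiable and one-to-one, and $B^{-1}$ is assumed to be defined at the arguments at which it is evaluated. A random sample is an i.i.d. sample. Upper record values: $R_1=X_1$, and subsequent upper records are the successive observations of an i.i.d. sequence from $F(\cdot;\theta)$ that exceed all previous observations. The joint density of the first $m$ upper record values is taken to be $f(r_m;\theta)\prod_{i=1}^{m-1}h(r_i;\theta)=B^m(\theta)\left\{\prod_{i=1}^mA'(r_i)\right\}\exp\{-B(\theta)A(r_m)\}$ for $r_1<\dots<r_m$, where $h=f/(1-F)$; in particular $A(R_m)$ has the Gamma distribution with shape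 $m$ and scale $1/B(\theta)$. *)

theory Defs
  imports "HOL-Probability.Probability"
begin

definition twice_differentiable_on :: "(real \<Rightarrow> real) \<Rightarrow> real set \<Rightarrow> bool" where
  "twice_differentiable_on f S \<longleftrightarrow>
     (\<exists>f'. (\<forall>t\<in>S. (f has_real_derivative f' t) (at t within S)) \<and> f' differentiable_on S)"

(* The support is [a, b) with b possibly infinite; "A(b) = +\<infinity>" is the left limit at b.
   A is required to be differentiable in the interior of the support and only continuous at a,
   which also admits Weibull-type A(x) = (x - a)^k with 0 < k < 1.
   Since A is a total function here, A_measurable fixes nothing but the behaviour of A outside
   the support, where its values are irrelevant. *)
locale exp_family_first_type =
  fixes a :: real and b :: ereal and A :: "real \<Rightarrow> real"
    and \<Theta> :: "real set" and B :: "real \<Rightarrow> real"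
  assumes support_nonempty: "ereal a < b"
    and A_mono: "mono_on {x. a \<le> x \<and> ereal x < b} A"
    and A_continuous: "continuous_on {x. a \<le> x \<and> ereal x < b} A"
    and A_differentiable: "A differentiable_on {x. a < x \<and> ereal x < b}"
    and A_left: "A a = 0"
    and A_right: "filterlim (\<lambda>x. A (real_of_ereal x)) at_top (at_left b)"
    and A_measurable: "A \<in> borel_measurable borel"
    and interval: "is_interval \<Theta>"
    and B_pos: "\<And>t. t \<in> \<Theta> \<Longrightarrow> B t > 0"
    and B_twice_differentiable: "twice_differentiable_on B \<Theta>"
    and B_inj: "inj_on B \<Theta>"

definition exp_family_cdf ::
  "real \<Rightarrow> ereal \<Rightarrow> (real \<Rightarrow> real) \<Rightarrow> (real \<Rightarrow> real) \<Rightarrow> real \<Rightarrow> real \<Rightarrow> real" where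
  "exp_family_cdf a b A B \<theta> x =
     (if x < a then 0 else if ereal x < b then 1 - exp (- (B \<theta> * A x)) else 1)"

definition iid_sample :: "'w measure \<Rightarrow> (real \<Rightarrow> real) \<Rightarrow> (nat \<Rightarrow> 'w \<Rightarrow> real) \<Rightarrow> bool" where
  "iid_sample M F X \<longleftrightarrow>
     prob_space.indep_vars M (\<lambda>_. borel) X UNIV \<and> (\<forall>i. cdf (distr M borel (X i)) = F)"

definition upper_record_indices :: "(nat \<Rightarrow> real) \<Rightarrow> nat set" where
  "upper_record_indices x = {k. \<forall>i<k. x i < x k}"

(* The m-th upper record value for m \<ge> 1, provided that x has at least m upper records. *)
definition upper_record_value :: "(nat \<Rightarrow> real) \<Rightarrow> nat \<Rightarrow> real" where
  "upper_record_value x m = x (enumerate (upper_record_indices x) (m - 1))"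

lemma upper_record_value_1: "upper_record_value x 1 = x 0"
  by (simp add: upper_record_value_def enumerate_0 upper_record_indices_def Least_eq_0)

(* B\<inverse> is the inverse of B as a map from \<Theta> onto B ` \<Theta>; its value elsewhere is unspecified. *)
definition record_mle ::
  "(real \<Rightarrow> real) \<Rightarrow> real set \<Rightarrow> (real \<Rightarrow> real) \<Rightarrow> (nat \<Rightarrow> real) \<Rightarrow> nat \<Rightarrow> real" where
  "record_mle A \<Theta> B x m = the_inv_into \<Theta> B (real m / A (upper_record_value x m))"

definition converges_in_probability ::
  "'w measure \<Rightarrow> (nat \<Rightarrow> 'w \<Rightarrow> real) \<Rightarrow> real \<Rightarrow> bool" where
  "converges_in_probability M Y c \<longleftrightarrow>
     (\<forall>m. Y m \<in> borel_measurable M) \<and>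
     (\<forall>\<epsilon>>0. (\<lambda>m. measure M {\<omega> \<in> space M. \<bar>Y m \<omega> - c\<bar> > \<epsilon>}) \<longlonglongrightarrow> 0)"

end

(* Among the first n observations the record indicators are pairwise independent with
   probabilities 1, 1/2, ..., 1/n, so by Chebyshev's inequality their number is close to the
   harmonic number, that is, to ln n. The variables B(theta) A(X_i) are standard exponential,
   hence their maximum over i < n is also close to ln n. Taking n = exp((1 - e) m) and
   n = exp((1 + e) m) brackets the m-th record value between two maxima, which gives
   B(theta) A(R_m) / m \<rightarrow> 1 in probability; the inverse of B is continuous on B(Theta). *)

theory Submission
  imports Defs "HOL-Real_Asymp.Real_Asymp"
begin

text \<open>The record values are read off an actual i.i.d. sequence, so no law of the transformed
  record is given in advance; comparing with maxima over nonrandom index ranges avoids deriving one.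
  Pairwise independence of the record indicators comes from an induction over events independent of
  the running maximum: an observation \<open>z\<close> beats \<open>k\<close> earlier ones with
  probability \<open>F z ^ k\<close>, and integrating over \<open>z\<close> gives
  \<open>1 / (k + 1)\<close>. As \<open>A\<close> is only nondecreasing, \<open>F\<close> may have
  flat stretches, so these integrals and the exponential tails go through the probability integral
  transform and not through an inverse of \<open>F\<close>. The choice of the ranges already shifts
  the maxima by \<open>e m\<close>; a further \<open>e m\<close> is left for their own fluctuation,
  hence the margin \<open>2 e\<close>. A path with fewer than \<open>m\<close> records, where the
  record value is a default, lies in the event of too few records in the longer range and needs no
  separate treatment.\<close>

subsection \<open>Probability integral transform\<close>

text \<open>The level \<open>u\<close> is attained by the intermediate value theorem, possibly on a
  whole interval. The sublevel set is the half line up to the last point of that level.\<close>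

lemma (in real_distribution) prob_cdf_le:
  assumes cont: "\<And>x. isCont (cdf M) x" and u: "0 < u" "u < 1"
  shows "measure M {x. cdf M x \<le> u} = u"
proof -
  define S where "S = {x. cdf M x \<le> u}"
  have "eventually (\<lambda>x. u < cdf M x) at_top"
    using order_tendstoD(1)[OF cdf_lim_at_top_prob] u by auto
  then obtain p where p: "\<And>x. x \<ge> p \<Longrightarrow> u < cdf M x"
    by (auto simp: eventually_at_top_linorder)
  have "eventually (\<lambda>x. cdf M x < u) at_bot"
    using order_tendstoD(2)[OF cdf_lim_at_bot] u by auto
  then obtain q where q: "\<And>x. x \<le> q \<Longrightarrow> cdf M x < u"
    by (auto simp: eventually_at_bot_linorder)
  have "q \<le> p"
    using p[of q] q[of q] by (meson less_asym' linear p q)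
  then obtain y where y: "cdf M y = u"
    using IVT[of "cdf M" q u p] p[of p] q[of q] cont by (auto simp: less_imp_le)
  have bdd: "bdd_above S"
    using p unfolding S_def bdd_above_def by (metis linear mem_Collect_eq not_le)
  have "closed S"
    unfolding S_def using cont
    by (intro closed_Collect_le) (auto simp: continuous_on_eq_continuous_at)
  moreover have "y \<in> S"
    by (simp add: S_def y)
  ultimately have c: "Sup S \<in> S"
    using bdd by (intro closed_contains_Sup) auto
  have S: "S = {..Sup S}"
    using cdf_nondecreasing bdd c by (fastforce intro: cSup_upper simp: S_def)
  have "u \<le> cdf M (Sup S)"
    using cdf_nondecreasing[of y "Sup S"] bdd \<open>y \<in> S\<close> y by (auto intro: cSup_upper)
  moreover have "cdf M (Sup S) \<le> u"
    using c by (simp add: S_def)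
  ultimately have "measure M {..Sup S} = u"
    by (simp add: cdf_def2)
  then show ?thesis
    using S by (simp add: S_def)
qed

lemma (in real_distribution) distr_cdf_uniform:
  assumes cont: "\<And>x. isCont (cdf M) x"
  shows "distr M borel (cdf M) = uniform_measure lborel {0..1}"
proof (rule cdf_unique)
  have [measurable]: "cdf M \<in> borel_measurable borel"
    using cont by (intro borel_measurable_continuous_onI) (auto simp: continuous_on_eq_continuous_at)
  interpret U: prob_space "uniform_measure lborel {0..1::real}"
    by (intro prob_space_uniform_measure) auto
  interpret D: prob_space "distr M borel (cdf M)"
    by (intro prob_space_distr) auto
  show "real_distribution (distr M borel (cdf M))"
    by unfold_locales auto
  show "real_distribution (uniform_measure lborel {0..1::real})"
    by unfold_locales auto
  show "cdf (distr M borel (cdf M)) = cdf (uniform_measure lborel {0..1::real})"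
  proof
    fix u :: real
    have D: "cdf (distr M borel (cdf M)) u = measure M {x. cdf M x \<le> u}"
      by (simp add: cdf_def[of "distr M borel (cdf M)"] measure_distr vimage_def)
    have U: "cdf (uniform_measure lborel {0..1::real}) u = measure lborel ({0..1} \<inter> {..u})"
      by (simp add: cdf_def measure_uniform_measure)
    consider "u < 0" | "u = 0" | "0 < u" "u < 1" | "1 \<le> u" by linarith
    then show "cdf (distr M borel (cdf M)) u = cdf (uniform_measure lborel {0..1::real}) u"
    proof cases
      case 1
      then have "{x. cdf M x \<le> u} = {}" "{0..1} \<inter> {..u} = {}"
        using cdf_nonneg by (auto simp: not_le intro: less_le_trans)
      then show ?thesis using D U by simp
    next
      case 2
      \<comment> \<open>At level 0 the sublevel set may be empty, which is why the previous lemma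
        starts above 0; monotonicity bounds its mass by every positive level.\<close>
      have "measure M {x. cdf M x \<le> 0} \<le> e" if "0 < e" for e
      proof (cases "e < 1")
        case True
        have "measure M {x. cdf M x \<le> 0} \<le> measure M {x. cdf M x \<le> e}"
          using that by (intro finite_measure_mono) auto
        then show ?thesis using prob_cdf_le[OF cont that True] by simp
      next
        case False
        then show ?thesis using prob_le_1[of "{x. cdf M x \<le> 0}"] by linarith
      qed
      then have "measure M {x. cdf M x \<le> 0} \<le> 0"
        by (meson dense_ge)
      then have "measure M {x. cdf M x \<le> 0} = 0"
        by (simp add: measure_le_0_iff)
      moreover have "{0..1} \<inter> {..u} = {0}" using 2 by auto
      ultimately show ?thesis using D U 2 by simp
    next
      case 3
      then have "{0..1} \<inter> {..u} = {0..u}" by auto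
      then show ?thesis using D U 3 prob_cdf_le[OF cont] by simp
    next
      case 4
      then have "{x. cdf M x \<le> u} = UNIV" "{0..1} \<inter> {..u} = {0..1}"
        using cdf_bounded_prob by (auto intro: order_trans)
      then show ?thesis using D U prob_space by simp
    qed
  qed
qed

text \<open>The integrand is the probability that \<open>k\<close> independent copies stay below
  \<open>x\<close>. After passing to a uniform variable this is the integral of a power, and it is
  the source of the factor \<open>1 / (k + 1)\<close> in the record probabilities.\<close>

lemma (in real_distribution) nn_integral_cdf_power:
  assumes cont: "\<And>x. isCont (cdf M) x"
  shows "(\<integral>\<^sup>+x. ennreal (cdf M x ^ k) * indicator {..<u} x \<partial>M) = ennreal (cdf M u ^ Suc k / Suc k)"
proof -
  have [measurable]: "cdf M \<in> borel_measurable borel"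
    using cont by (intro borel_measurable_continuous_onI) (auto simp: continuous_on_eq_continuous_at)
  let ?u = "cdf M u"
  have u: "0 \<le> ?u" "?u \<le> 1"
    using cdf_nonneg cdf_bounded_prob by auto
  have "measure M {x. cdf M x \<le> ?u} = measure (distr M borel (cdf M)) {..?u}"
    by (simp add: measure_distr vimage_def)
  also have "\<dots> = measure lborel ({0..1} \<inter> {..?u})"
    by (simp add: distr_cdf_uniform[OF cont] measure_uniform_measure)
  also have "{0..1} \<inter> {..?u} = {0..?u}"
    using u by auto
  also have "measure lborel {0..?u} = ?u"
    using u by simp
  finally have "measure M {x. cdf M x \<le> ?u} = ?u" .
  moreover have "measure M {..<u} = ?u"
    using cdf_at_left cont[of u] by (metis isCont_def filterlim_at_split tendsto_unique trivial_limit_at_left_real)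
  moreover have sub: "{..<u} \<subseteq> {x. cdf M x \<le> ?u}"
    using cdf_nondecreasing by auto
  \<comment> \<open>The larger set also contains any flat stretch to the right of \<open>u\<close>.
    Both sets have mass \<open>cdf M u\<close>, so the surplus is null and the indicator can be
    rewritten in terms of \<open>cdf M x\<close> alone.\<close>
  ultimately have "measure M ({x. cdf M x \<le> ?u} - {..<u}) = 0"
    by (subst finite_measure_Diff) auto
  then have "{x. cdf M x \<le> ?u} - {..<u} \<in> null_sets M"
    by (simp add: null_sets_def emeasure_eq_measure)
  then have "AE x in M. x \<notin> {x. cdf M x \<le> ?u} - {..<u}"
    by (rule AE_not_in)
  then have "(\<integral>\<^sup>+x. ennreal (cdf M x ^ k) * indicator {..<u} x \<partial>M)
    = (\<integral>\<^sup>+x. ennreal (cdf M x ^ k) * indicator {..?u} (cdf M x) \<partial>M)"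
    using sub by (intro nn_integral_cong_AE) (auto split: split_indicator)
  also have "\<dots> = (\<integral>\<^sup>+v. ennreal (v ^ k) * indicator {..?u} v \<partial>distr M borel (cdf M))"
    by (subst nn_integral_distr) auto
  also have "\<dots> = (\<integral>\<^sup>+v. ennreal (v ^ k) * indicator {..?u} v * indicator {0..1} v \<partial>lborel)"
    by (simp add: distr_cdf_uniform[OF cont] nn_integral_uniform_measure divide_ennreal_def)
  also have "\<dots> = (\<integral>\<^sup>+v. ennreal (v ^ k) * indicator {0..?u} v \<partial>lborel)"
    using u by (intro nn_integral_cong) (auto split: split_indicator)
  also have "\<dots> = ennreal (?u ^ Suc k / Suc k - 0 ^ Suc k / Suc k)"
    using u by (intro nn_integral_FTC_Icc)
      (auto simp del: power_Suc intro!: derivative_eq_intros)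
  finally show ?thesis
    by simp
qed

subsection \<open>Records of a sequence\<close>

text \<open>On a finite set \<open>enumerate\<close> is meaningful only while elements remain. The
  hypothesis guarantees more than \<open>k\<close> of them, so the set of records never has to be
  infinite. Removing the least element lowers the index by one, hence the induction over arbitrary
  \<open>S\<close>.\<close>

lemma enumerate_card_lessThan:
  fixes S :: "nat set"
  assumes "k < card (S \<inter> {..<n})"
  shows "enumerate S k \<in> S \<and> card (S \<inter> {..<enumerate S k}) = k"
  using assms
proof (induction k arbitrary: S)
  case 0
  then have "S \<noteq> {}" by auto
  then have "(LEAST s. s \<in> S) \<in> S" by (auto intro: LeastI)
  moreover have "S \<inter> {..<LEAST s. s \<in> S} = {}"
    using not_less_Least by auto
  ultimately show ?case
    by (simp add: enumerate_0)
next
  case (Suc k)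
  define l where "l = enumerate S 0"
  have "S \<noteq> {}" using Suc.prems by auto
  then have l: "l \<in> S" and least: "\<And>s. s \<in> S \<Longrightarrow> l \<le> s"
    by (auto simp: l_def enumerate_0 intro: LeastI Least_le)
  have "card (S \<inter> {..<n}) \<le> card (insert l ((S - {l}) \<inter> {..<n}))"
    by (intro card_mono) auto
  with Suc.prems have "k < card ((S - {l}) \<inter> {..<n})"
    by (simp add: card_insert_if)
  from Suc.IH[OF this] have e: "enumerate S (Suc k) \<in> S - {l}"
    "card ((S - {l}) \<inter> {..<enumerate S (Suc k)}) = k"
    by (auto simp: enumerate_Suc' l_def)
  then have "l < enumerate S (Suc k)"
    using least by (simp add: le_neq_trans)
  then have "S \<inter> {..<enumerate S (Suc k)} = insert l ((S - {l}) \<inter> {..<enumerate S (Suc k)})"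
    using l by auto
  then show ?case
    using e by simp
qed

lemma measurable_enumerate:
  assumes "\<And>j. Measurable.pred M (\<lambda>\<omega>. j \<in> S \<omega>)"
  shows "(\<lambda>\<omega>. enumerate (S \<omega> :: nat set) k) \<in> M \<rightarrow>\<^sub>M count_space UNIV"
  using assms
proof (induction k arbitrary: S)
  case 0
  note [measurable] = 0
  show ?case
    by (simp add: enumerate_0)
next
  case (Suc k)
  note [measurable] = Suc.prems
  have [measurable]: "(\<lambda>\<omega>. enumerate (S \<omega>) 0) \<in> M \<rightarrow>\<^sub>M count_space UNIV"
    by (simp add: enumerate_0)
  have "Measurable.pred M (\<lambda>\<omega>. j \<in> S \<omega> - {enumerate (S \<omega>) 0})" for j
    by simp
  from Suc.IH[OF this] show ?case
    by (simp add: enumerate_Suc')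
qed

text \<open>The record time takes countably many values and is measurable even on paths with too few
  records, so the default value there does no harm.\<close>

lemma measurable_upper_record_value:
  assumes [measurable]: "\<And>i. X i \<in> borel_measurable M"
  shows "(\<lambda>\<omega>. upper_record_value (\<lambda>i. X i \<omega>) m) \<in> borel_measurable M"
proof -
  have "Measurable.pred M (\<lambda>\<omega>. j \<in> upper_record_indices (\<lambda>i. X i \<omega>))" for j
    unfolding upper_record_indices_def by simp
  note [measurable] = measurable_enumerate[OF this]
  show ?thesis
    unfolding upper_record_value_def by (rule measurable_compose_countable) auto
qed

text \<open>The two counts force the time \<open>k\<close> of the \<open>m\<close>-th record into
  \<open>n1 <= k < n2\<close>. Being a record at or after \<open>n1\<close>, the value dominates the
  first \<open>n1\<close> entries, and being attained before \<open>n2\<close>, it is one of the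
  first \<open>n2\<close>.\<close>

lemma upper_record_value_bracket:
  assumes "card (upper_record_indices x \<inter> {..<n1}) < m" "m \<le> card (upper_record_indices x \<inter> {..<n2})"
  obtains k where "k < n2" "upper_record_value x m = x k" "\<And>i. i < n1 \<Longrightarrow> x i \<le> x k"
proof -
  define S where "S = upper_record_indices x"
  define k where "k = enumerate S (m - 1)"
  \<comment> \<open>The first count being below \<open>m\<close> makes \<open>m\<close> positive, so
    the subtraction is not truncated.\<close>
  have "m - 1 < card (S \<inter> {..<n2})"
    using assms by (simp add: S_def)
  from enumerate_card_lessThan[OF this] have k: "k \<in> S" "card (S \<inter> {..<k}) = m - 1"
    by (auto simp: k_def)
  have "k < n2"
  proof (rule ccontr)
    assume "\<not> k < n2"
    then have "card (S \<inter> {..<n2}) \<le> card (S \<inter> {..<k})"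
      by (intro card_mono) auto
    then show False
      using k assms by (simp add: S_def)
  qed
  moreover have "n1 \<le> k"
  proof (rule ccontr)
    assume "\<not> n1 \<le> k"
    then have "card (insert k (S \<inter> {..<k})) \<le> card (S \<inter> {..<n1})"
      using k by (intro card_mono) auto
    then show False
      using k assms by (simp add: S_def)
  qed
  then have "x i \<le> x k" if "i < n1" for i
    using that k(1) by (auto simp: S_def upper_record_indices_def less_imp_le)
  moreover have "upper_record_value x m = x k"
    by (simp add: upper_record_value_def k_def S_def)
  ultimately show ?thesis
    using that by blast
qed

subsection \<open>Records in a sample with continuous distribution function\<close>

text \<open>Record counts are distribution free: the common law enters only through the continuity
  of \<open>F\<close>, which rules out ties almost surely.\<close>

locale iid_continuous = prob_space M
  for M :: "'w measure" and X :: "nat \<Rightarrow> 'w \<Rightarrow> real" and F :: "real \<Rightarrow> real" +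
  assumes indep: "indep_vars (\<lambda>_. borel) X UNIV"
    and cdf_X: "\<And>i. cdf (distr M borel (X i)) = F"
    and F_cont: "\<And>x. isCont F x"
begin

lemma X_measurable [measurable]: "X i \<in> borel_measurable M"
  using indep by (auto simp: indep_vars_def)

lemma real_distribution_X: "real_distribution (distr M borel (X i))"
  by simp

lemma F_nonneg: "0 \<le> F x"
  using finite_borel_measure.cdf_nonneg[OF real_distribution.finite_borel_measure_M[OF real_distribution_X]] cdf_X
  by metis

lemma F_at_top: "(F \<longlongrightarrow> 1) at_top"
  using real_distribution.cdf_lim_at_top_prob[OF real_distribution_X] cdf_X by metis

lemma F_measurable [measurable]: "F \<in> borel_measurable borel"
  using F_cont by (intro borel_measurable_continuous_onI) (auto simp: continuous_on_eq_continuous_at)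

lemma prob_X_le: "prob {\<omega>\<in>space M. X i \<omega> \<le> x} = F x"
  using fun_cong[OF cdf_X[of i], of x]
  by (simp add: cdf_def measure_distr vimage_def Int_def conj_commute)

lemma measure_distr_X_less: "measure (distr M borel (X i)) {..<x} = F x"
proof -
  interpret D: real_distribution "distr M borel (X i)"
    by (rule real_distribution_X)
  have "(F \<longlongrightarrow> measure (distr M borel (X i)) {..<x}) (at_left x)"
    using D.cdf_at_left[of x] cdf_X by simp
  moreover have "(F \<longlongrightarrow> F x) (at_left x)"
    using F_cont[of x] by (simp add: isCont_def filterlim_at_split)
  ultimately show ?thesis
    using tendsto_unique trivial_limit_at_left_real by blast
qed

text \<open>Conditioning on \<open>X k\<close>, which is independent of the block of its
  predecessors. Independence of blocks concerns restricted families, so \<open>X k\<close> first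
  appears as a family over \<open>{k}\<close> and is then evaluated at \<open>k\<close>.\<close>

lemma emeasure_fubini:
  assumes [measurable]: "Measurable.pred (PiM {..<k} (\<lambda>_. borel) \<Otimes>\<^sub>M borel) (\<lambda>p. R (fst p) (snd p))"
  shows "emeasure M {\<omega>\<in>space M. R (restrict (\<lambda>i. X i \<omega>) {..<k}) (X k \<omega>)}
    = (\<integral>\<^sup>+z. emeasure M {\<omega>\<in>space M. R (restrict (\<lambda>i. X i \<omega>) {..<k}) z} \<partial>distr M borel (X k))"
proof -
  let ?N = "PiM {..<k} (\<lambda>_. borel :: real measure)"
  let ?Y = "\<lambda>\<omega>. restrict (\<lambda>i. X i \<omega>) {..<k}"
  have Y [measurable]: "?Y \<in> M \<rightarrow>\<^sub>M ?N"
    by (intro measurable_restrict) auto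
  let ?K = "PiM {k} (\<lambda>_. borel :: real measure)"
  let ?Z = "\<lambda>\<omega>. restrict (\<lambda>i. X i \<omega>) {k}"
  have Z [measurable]: "?Z \<in> M \<rightarrow>\<^sub>M ?K"
    by (intro measurable_restrict) auto
  have "indep_var ?N ?Y ?K ?Z"
    by (intro indep_var_restrict[OF indep]) auto
  then have joint: "distr M (?N \<Otimes>\<^sub>M ?K) (\<lambda>\<omega>. (?Y \<omega>, ?Z \<omega>)) = distr M ?N ?Y \<Otimes>\<^sub>M distr M ?K ?Z"
    by (simp add: indep_var_distribution_eq)
  interpret Y: prob_space "distr M ?N ?Y"
    by (rule prob_space_distr[OF Y])
  interpret Z: prob_space "distr M ?K ?Z"
    by (rule prob_space_distr[OF Z])
  interpret pair_sigma_finite "distr M ?N ?Y" "distr M ?K ?Z" ..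
  interpret YX: pair_sigma_finite "distr M ?N ?Y" "distr M borel (X k)"
    using real_distribution_X[of k]
    by (simp add: pair_sigma_finite_def real_distribution_def prob_space_imp_sigma_finite Y.sigma_finite_measure_axioms)
  let ?S = "{p \<in> space (?N \<Otimes>\<^sub>M borel). R (fst p) (snd p)}"
  have S [measurable]: "?S \<in> sets (?N \<Otimes>\<^sub>M borel)"
    by measurable
  let ?S' = "{p \<in> space (?N \<Otimes>\<^sub>M ?K). R (fst p) (snd p k)}"
  have f: "(\<lambda>p. (fst p, snd p k)) \<in> ?N \<Otimes>\<^sub>M ?K \<rightarrow>\<^sub>M ?N \<Otimes>\<^sub>M borel"
    by measurable
  have "(\<lambda>p. (fst p, snd p k)) -` ?S \<inter> space (?N \<Otimes>\<^sub>M ?K) = ?S'"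
    by (auto simp: space_pair_measure)
  then have S' [measurable]: "?S' \<in> sets (?N \<Otimes>\<^sub>M ?K)"
    using measurable_sets[OF f S] by simp
  define G where "G z = emeasure (distr M ?N ?Y) ((\<lambda>y. (y, z)) -` ?S)" for z
  have G [measurable]: "G \<in> borel_measurable borel"
    using YX.measurable_emeasure_Pair2[of ?S] by (simp add: G_def[abs_def] cong: sets_pair_measure_cong measurable_cong_sets)
  have Yspace: "?Y \<omega> \<in> space ?N" if "\<omega> \<in> space M" for \<omega>
    using measurable_space[OF Y that] .
  have Zspace: "?Z \<omega> \<in> space ?K" if "\<omega> \<in> space M" for \<omega>
    using measurable_space[OF Z that] .
  have "emeasure M {\<omega>\<in>space M. R (?Y \<omega>) (X k \<omega>)} = emeasure (distr M (?N \<Otimes>\<^sub>M ?K) (\<lambda>\<omega>. (?Y \<omega>, ?Z \<omega>))) ?S'"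
    using Yspace Zspace
    by (subst emeasure_distr) (auto intro!: arg_cong[where f="emeasure M"] simp: space_pair_measure)
  also have "\<dots> = (\<integral>\<^sup>+f. emeasure (distr M ?N ?Y) ((\<lambda>y. (y, f)) -` ?S') \<partial>distr M ?K ?Z)"
    unfolding joint by (intro emeasure_pair_measure_alt2) (simp cong: sets_pair_measure_cong)
  also have "\<dots> = (\<integral>\<^sup>+f. G (f k) \<partial>distr M ?K ?Z)"
    unfolding G_def by (intro nn_integral_cong arg_cong[where f="emeasure _"]) (auto simp: space_pair_measure)
  also have "\<dots> = (\<integral>\<^sup>+z. G z \<partial>distr M borel (X k))"
    by (subst (1 2) nn_integral_distr) auto
  also have "\<dots> = (\<integral>\<^sup>+z. emeasure M {\<omega>\<in>space M. R (?Y \<omega>) z} \<partial>distr M borel (X k))"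
  proof (intro nn_integral_cong)
    fix z :: real
    have "(\<lambda>y. (y, z)) -` ?S \<in> sets ?N"
      by (rule sets_Pair2[OF S])
    then show "G z = emeasure M {\<omega>\<in>space M. R (?Y \<omega>) z}"
      using Yspace unfolding G_def
      by (subst emeasure_distr) (auto intro!: arg_cong[where f="emeasure M"] simp: space_pair_measure)
  qed
  finally show ?thesis .
qed

text \<open>As \<open>F ^ k\<close> is the distribution function of the maximum of the first \<open>k\<close> observations,
  the condition makes \<open>P\<close> independent of this maximum. It survives the addition of an
  observation, with or without the requirement that the new one is a record, which yields the
  joint probabilities of records without any appeal to exchangeability.\<close>

definition indep_of_max :: "nat \<Rightarrow> ((nat \<Rightarrow> real) \<Rightarrow> bool) \<Rightarrow> real \<Rightarrow> bool" where
  "indep_of_max k P q \<longleftrightarrow> 0 \<le> q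
     \<and> Measurable.pred (PiM {..<k} (\<lambda>_. borel)) P
     \<and> (\<forall>f. P (restrict f {..<k}) = P f)
     \<and> (\<forall>x. prob {\<omega>\<in>space M. P (\<lambda>i. X i \<omega>) \<and> (\<forall>i<k. X i \<omega> < x)} = q * F x ^ k)"

lemma indep_of_max_0: "indep_of_max 0 (\<lambda>_. True) 1"
  by (simp add: indep_of_max_def prob_space)

lemma indep_of_max_measurable:
  assumes "indep_of_max k P q" "k \<le> n"
  shows "Measurable.pred (PiM {..<n} (\<lambda>_. borel)) P"
proof -
  have [measurable]: "Measurable.pred (PiM {..<k} (\<lambda>_. borel)) P"
    and "\<And>f. P (restrict f {..<k}) = P f"
    using assms by (auto simp: indep_of_max_def)
  moreover have [measurable]: "(\<lambda>f. restrict f {..<k}) \<in> PiM {..<n} (\<lambda>_. borel :: real measure) \<rightarrow>\<^sub>M PiM {..<k} (\<lambda>_. borel)"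
    using assms by (intro measurable_restrict_subset) auto
  have "Measurable.pred (PiM {..<n} (\<lambda>_. borel)) (\<lambda>f. P (restrict f {..<k}))"
    by measurable
  ultimately show ?thesis
    by simp
qed

lemma indep_of_max_restrict:
  assumes "indep_of_max k P q" "k \<le> n"
  shows "P (restrict f {..<n}) = P f"
proof -
  have *: "\<And>f. P (restrict f {..<k}) = P f"
    using assms by (auto simp: indep_of_max_def)
  have "P (restrict (restrict f {..<n}) {..<k}) = P (restrict f {..<k})"
    using assms by (intro arg_cong[where f=P]) (auto simp: restrict_def)
  then show ?thesis
    by (simp only: *)
qed

text \<open>Given \<open>X k = z\<close>, the event has probability \<open>q * F x ^ k\<close> if
  \<open>z < x\<close> and is empty otherwise; integration contributes the mass \<open>F x\<close>
  of \<open>{..<x}\<close>.\<close>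

lemma indep_of_max_Suc:
  assumes P: "indep_of_max k P q"
  shows "indep_of_max (Suc k) P q"
proof -
  note [measurable] = indep_of_max_measurable[OF P order_refl]
  have res: "P (restrict f {..<k}) = P f" for f
    using P by (auto simp: indep_of_max_def)
  have "prob {\<omega>\<in>space M. P (\<lambda>i. X i \<omega>) \<and> (\<forall>i<Suc k. X i \<omega> < x)} = q * F x ^ Suc k" for x
  proof -
    have "emeasure M {\<omega>\<in>space M. P (\<lambda>i. X i \<omega>) \<and> (\<forall>i<Suc k. X i \<omega> < x)}
      = emeasure M {\<omega>\<in>space M. (\<lambda>y z. (P y \<and> (\<forall>i\<in>{..<k}. y i < x)) \<and> z < x)
          (restrict (\<lambda>i. X i \<omega>) {..<k}) (X k \<omega>)}"
      by (intro arg_cong[where f="emeasure M"]) (auto simp: res less_Suc_eq)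
    also have "\<dots> = (\<integral>\<^sup>+z. emeasure M {\<omega>\<in>space M. (\<lambda>y z. (P y \<and> (\<forall>i\<in>{..<k}. y i < x)) \<and> z < x)
          (restrict (\<lambda>i. X i \<omega>) {..<k}) z} \<partial>distr M borel (X k))"
      by (rule emeasure_fubini) measurable
    also have "\<dots> = (\<integral>\<^sup>+z. ennreal (q * F x ^ k) * indicator {..<x} z \<partial>distr M borel (X k))"
    proof (intro nn_integral_cong)
      fix z
      have "emeasure M {\<omega>\<in>space M. P (\<lambda>i. X i \<omega>) \<and> (\<forall>i<k. X i \<omega> < x)} = ennreal (q * F x ^ k)"
        using P by (simp add: emeasure_eq_measure indep_of_max_def)
      then show "emeasure M {\<omega>\<in>space M. (\<lambda>y z. (P y \<and> (\<forall>i\<in>{..<k}. y i < x)) \<and> z < x)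
          (restrict (\<lambda>i. X i \<omega>) {..<k}) z} = ennreal (q * F x ^ k) * indicator {..<x} z"
        by (cases "z < x") (auto simp: res Ball_def)
    qed
    also have "\<dots> = ennreal (q * F x ^ k) * ennreal (F x)"
      using measure_distr_X_less[of k x] finite_measure.emeasure_eq_measure[OF real_distribution.axioms(1)[OF real_distribution_X[of k], THEN prob_space.finite_measure]]
      by (simp add: nn_integral_cmult)
    also have "\<dots> = ennreal (q * F x ^ Suc k)"
      using P F_nonneg by (simp add: ennreal_mult[symmetric] indep_of_max_def mult_ac)
    finally show ?thesis
      using P F_nonneg by (subst (asm) emeasure_eq_measure) (simp add: indep_of_max_def)
  qed
  then show ?thesis
    using P indep_of_max_measurable[OF P, of "Suc k"] indep_of_max_restrict[OF P, of "Suc k"]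
    by (simp add: indep_of_max_def)
qed

lemma indep_of_max_mono:
  assumes "k \<le> n" "indep_of_max k P q"
  shows "indep_of_max n P q"
  using assms by (induction n rule: dec_induct) (auto intro: indep_of_max_Suc)

text \<open>A record is itself the new maximum. Given \<open>X k = z < x\<close>, the predecessors
  must satisfy \<open>P\<close> and stay below \<open>z\<close>, with probability
  \<open>q * F z ^ k\<close>; integrating over \<open>z < x\<close> keeps the product form and
  divides \<open>q\<close> by \<open>k + 1\<close>.\<close>

lemma indep_of_max_record:
  assumes P: "indep_of_max k P q"
  shows "indep_of_max (Suc k) (\<lambda>f. P f \<and> (\<forall>i<k. f i < f k)) (q / Suc k)"
proof -
  note [measurable] = indep_of_max_measurable[OF P order_refl]
  have res: "P (restrict f {..<k}) = P f" for f
    using P by (auto simp: indep_of_max_def)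
  have q: "0 \<le> q"
    using P by (auto simp: indep_of_max_def)
  have "prob {\<omega>\<in>space M. (P (\<lambda>i. X i \<omega>) \<and> (\<forall>i<k. X i \<omega> < X k \<omega>)) \<and> (\<forall>i<Suc k. X i \<omega> < x)}
    = q / Suc k * F x ^ Suc k" for x
  proof -
    have "emeasure M {\<omega>\<in>space M. (P (\<lambda>i. X i \<omega>) \<and> (\<forall>i<k. X i \<omega> < X k \<omega>)) \<and> (\<forall>i<Suc k. X i \<omega> < x)}
      = emeasure M {\<omega>\<in>space M. (\<lambda>y z. (P y \<and> (\<forall>i\<in>{..<k}. y i < z)) \<and> z < x)
          (restrict (\<lambda>i. X i \<omega>) {..<k}) (X k \<omega>)}"
      by (intro arg_cong[where f="emeasure M"]) (auto simp: res less_Suc_eq intro: less_trans)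
    also have "\<dots> = (\<integral>\<^sup>+z. emeasure M {\<omega>\<in>space M. (\<lambda>y z. (P y \<and> (\<forall>i\<in>{..<k}. y i < z)) \<and> z < x)
          (restrict (\<lambda>i. X i \<omega>) {..<k}) z} \<partial>distr M borel (X k))"
      by (rule emeasure_fubini) measurable
    also have "\<dots> = (\<integral>\<^sup>+z. ennreal q * (ennreal (F z ^ k) * indicator {..<x} z) \<partial>distr M borel (X k))"
    proof (intro nn_integral_cong)
      fix z
      have "emeasure M {\<omega>\<in>space M. P (\<lambda>i. X i \<omega>) \<and> (\<forall>i<k. X i \<omega> < z)} = ennreal (q * F z ^ k)"
        using P by (simp add: emeasure_eq_measure indep_of_max_def)
      then show "emeasure M {\<omega>\<in>space M. (\<lambda>y z. (P y \<and> (\<forall>i\<in>{..<k}. y i < z)) \<and> z < x)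
          (restrict (\<lambda>i. X i \<omega>) {..<k}) z} = ennreal q * (ennreal (F z ^ k) * indicator {..<x} z)"
        using q F_nonneg by (cases "z < x") (auto simp: res Ball_def ennreal_mult)
    qed
    also have "\<dots> = ennreal q * ennreal (F x ^ Suc k / Suc k)"
      using real_distribution.nn_integral_cdf_power[OF real_distribution_X[of k], of k x] F_cont
      by (simp add: nn_integral_cmult cdf_X)
    also have "\<dots> = ennreal (q / Suc k * F x ^ Suc k)"
      using q F_nonneg by (subst ennreal_mult[symmetric]) auto
    finally show ?thesis
      using q F_nonneg by (subst (asm) emeasure_eq_measure) simp
  qed
  moreover have "Measurable.pred (PiM {..<Suc k} (\<lambda>_. borel)) (\<lambda>f. P f \<and> (\<forall>i\<in>{..<k}. f i < f k))"
    using indep_of_max_measurable[OF P, of "Suc k"] by measurable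
  moreover have "P (restrict f {..<Suc k}) = P f" for f
    using indep_of_max_restrict[OF P, of "Suc k"] by simp
  ultimately show ?thesis
    using q by (simp add: indep_of_max_def Ball_def)
qed

text \<open>Letting the bound on the maximum run through the naturals removes it, while
  \<open>F x ^ k\<close> tends to 1.\<close>

lemma prob_indep_of_max:
  assumes P: "indep_of_max k P q"
  shows "{\<omega>\<in>space M. P (\<lambda>i. X i \<omega>)} \<in> events" "prob {\<omega>\<in>space M. P (\<lambda>i. X i \<omega>)} = q"
proof -
  note [measurable] = indep_of_max_measurable[OF P order_refl]
  have res: "P (restrict f {..<k}) = P f" for f
    using P by (auto simp: indep_of_max_def)
  have "{\<omega>\<in>space M. P (restrict (\<lambda>i. X i \<omega>) {..<k})} \<in> events"
    by measurable
  then show ev [measurable]: "{\<omega>\<in>space M. P (\<lambda>i. X i \<omega>)} \<in> events"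
    by (simp add: res)
  let ?A = "\<lambda>n. {\<omega>\<in>space M. P (\<lambda>i. X i \<omega>) \<and> (\<forall>i<k. X i \<omega> < real n)}"
  have "(\<lambda>n. prob (?A n)) \<longlonglongrightarrow> prob (\<Union>n. ?A n)"
    by (intro finite_Lim_measure_incseq) (auto simp: incseq_def intro: less_le_trans)
  also have "(\<Union>n. ?A n) = {\<omega>\<in>space M. P (\<lambda>i. X i \<omega>)}"
  proof -
    have "\<exists>n. \<forall>i<k. X i \<omega> < real n" for \<omega>
    proof -
      obtain n where n: "Max (insert 0 ((\<lambda>i. X i \<omega>) ` {..<k})) < real n"
        using reals_Archimedean2 by blast
      have "X i \<omega> < real n" if "i < k" for i
        using that by (intro le_less_trans[OF Max_ge n]) auto
      then show ?thesis by blast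
    qed
    then show ?thesis by auto
  qed
  finally have 1: "(\<lambda>n. prob (?A n)) \<longlonglongrightarrow> prob {\<omega>\<in>space M. P (\<lambda>i. X i \<omega>)}" .
  have "(\<lambda>n. q * F (real n) ^ k) \<longlonglongrightarrow> q * 1 ^ k"
    by (intro tendsto_intros filterlim_compose[OF F_at_top] filterlim_real_sequentially)
  moreover have "prob (?A n) = q * F (real n) ^ k" for n
    using P by (simp add: indep_of_max_def)
  ultimately show "prob {\<omega>\<in>space M. P (\<lambda>i. X i \<omega>)} = q"
    using 1 by (simp add: LIMSEQ_unique)
qed

end

section \<open>Mean and variance of the number of records\<close>

context iid_continuous
begin

definition record_event :: "nat \<Rightarrow> 'w set" where
  "record_event k = {\<omega>\<in>space M. k \<in> upper_record_indices (\<lambda>i. X i \<omega>)}"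

lemma record_event_measurable [measurable]: "record_event k \<in> events"
  unfolding record_event_def upper_record_indices_def by measurable

lemma indep_of_max_True: "indep_of_max k (\<lambda>_. True) 1"
  using indep_of_max_mono[OF le0 indep_of_max_0] .

lemma prob_record_event: "prob (record_event k) = 1 / Suc k"
  using prob_indep_of_max(2)[OF indep_of_max_record[OF indep_of_max_True]]
  by (simp add: record_event_def upper_record_indices_def)

lemma prob_record_event_Int:
  assumes "j \<noteq> k"
  shows "prob (record_event j \<inter> record_event k) = 1 / Suc j * (1 / Suc k)"
proof -
  have *: "prob (record_event j \<inter> record_event k) = 1 / Suc j * (1 / Suc k)" if "j < k" for j k
  proof -
    \<comment> \<open>The record at the earlier time \<open>j\<close> is carried along unchanged to
      time \<open>k\<close>, where requiring a second record multiplies by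
      \<open>1 / (k + 1)\<close>.\<close>
    have "indep_of_max k (\<lambda>f. True \<and> (\<forall>i<j. f i < f j)) (1 / Suc j)"
      using that by (intro indep_of_max_mono[OF _ indep_of_max_record[OF indep_of_max_True]]) simp
    from prob_indep_of_max(2)[OF indep_of_max_record[OF this]] show ?thesis
      by (simp add: record_event_def upper_record_indices_def Int_def conj_ac)
  qed
  show ?thesis
    using assms *[of j k] *[of k j] by (cases j k rule: linorder_cases) (auto simp: Int_commute)
qed

lemma record_count_measurable [measurable]:
  "(\<lambda>\<omega>. real (card (upper_record_indices (\<lambda>i. X i \<omega>) \<inter> {..<n}))) \<in> borel_measurable M"
  and record_count_eq_sum: "\<omega> \<in> space M \<Longrightarrow>
    real (card (upper_record_indices (\<lambda>i. X i \<omega>) \<inter> {..<n})) = (\<Sum>k<n. indicator (record_event k) \<omega>)"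
proof -
  show *: "real (card (upper_record_indices (\<lambda>i. X i \<omega>) \<inter> {..<n})) = (\<Sum>k<n. indicator (record_event k) \<omega>)"
    if "\<omega> \<in> space M" for \<omega>
  proof -
    have "(\<Sum>k<n. indicator (record_event k) \<omega> :: real)
      = (\<Sum>k<n. indicator (upper_record_indices (\<lambda>i. X i \<omega>)) k)"
      using that by (intro sum.cong) (auto simp: record_event_def indicator_def)
    also have "\<dots> = real (card (upper_record_indices (\<lambda>i. X i \<omega>) \<inter> {..<n}))"
      by (simp add: indicator_def sum_of_bool_eq Int_def conj_commute)
    finally show ?thesis by simp
  qed
  show "(\<lambda>\<omega>. real (card (upper_record_indices (\<lambda>i. X i \<omega>) \<inter> {..<n}))) \<in> borel_measurable M"
    by (subst measurable_cong[OF *]) auto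
qed

text \<open>Since \<open>harm n\<close> is the expected count, this bounds the variance. The square
  is expanded into covariances of record indicators, for which pairwise independence
  suffices.\<close>

lemma expectation_record_count_deviation:
  "integrable M (\<lambda>\<omega>. (real (card (upper_record_indices (\<lambda>i. X i \<omega>) \<inter> {..<n})) - harm n)\<^sup>2)"
  "expectation (\<lambda>\<omega>. (real (card (upper_record_indices (\<lambda>i. X i \<omega>) \<inter> {..<n})) - harm n)\<^sup>2) \<le> harm n"
proof -
  define p :: "nat \<Rightarrow> real" where "p k = 1 / Suc k" for k
  define D :: "nat \<Rightarrow> 'w \<Rightarrow> real" where "D k \<omega> = indicator (record_event k) \<omega> - p k" for k \<omega>
  have pr: "prob (record_event k) = p k" for k
    by (simp add: prob_record_event p_def)
  have harm: "harm n = (\<Sum>k<n. p k)"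
    by (simp add: harm_altdef p_def inverse_eq_divide)
  have eq: "(real (card (upper_record_indices (\<lambda>i. X i \<omega>) \<inter> {..<n})) - harm n)\<^sup>2
    = (\<Sum>j<n. \<Sum>k<n. D j \<omega> * D k \<omega>)" if "\<omega> \<in> space M" for \<omega>
    using that
    by (simp add: record_count_eq_sum harm D_def power2_eq_square sum_product[symmetric] sum_subtractf)
  have int: "has_bochner_integral M (\<lambda>\<omega>. D j \<omega> * D k \<omega>)
    (prob (record_event j \<inter> record_event k) - p j * p k)" for j k
  proof -
    have "has_bochner_integral M (\<lambda>\<omega>. indicator (record_event j \<inter> record_event k) \<omega>
      - p k * indicator (record_event j) \<omega> - p j * indicator (record_event k) \<omega> + p j * p k)
      (prob (record_event j \<inter> record_event k) - p k * prob (record_event j)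
        - p j * prob (record_event k) + p j * p k * prob (space M))"
    proof -
      have [simp]: "integrable M (indicat_real (record_event i))" for i
        by (intro integrable_real_indicator) (auto simp: less_top[symmetric])
      have [simp]: "integrable M (indicat_real (record_event j \<inter> record_event k))"
        by (intro integrable_real_indicator) (auto simp: less_top[symmetric])
      show ?thesis
        by (simp add: has_bochner_integral_iff prob_space)
    qed
    then show ?thesis
      by (simp add: D_def pr prob_space algebra_simps indicator_inter_arith)
  qed
  have sum: "has_bochner_integral M (\<lambda>\<omega>. \<Sum>j<n. \<Sum>k<n. D j \<omega> * D k \<omega>)
    (\<Sum>j<n. \<Sum>k<n. prob (record_event j \<inter> record_event k) - p j * p k)"
    by (intro has_bochner_integral_sum int)
  then show "integrable M (\<lambda>\<omega>. (real (card (upper_record_indices (\<lambda>i. X i \<omega>) \<inter> {..<n})) - harm n)\<^sup>2)"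
    using eq by (subst Bochner_Integration.integrable_cong[OF refl eq]) (auto simp: has_bochner_integral_iff)
  have "expectation (\<lambda>\<omega>. (real (card (upper_record_indices (\<lambda>i. X i \<omega>) \<inter> {..<n})) - harm n)\<^sup>2)
    = (\<Sum>j<n. \<Sum>k<n. prob (record_event j \<inter> record_event k) - p j * p k)"
    using sum by (subst Bochner_Integration.integral_cong[OF refl eq]) (auto simp: has_bochner_integral_iff)
  \<comment> \<open>Off the diagonal the covariances vanish; on it they are
    \<open>p j - p j * p j\<close>, at most \<open>p j\<close>.\<close>
  also have "\<dots> \<le> (\<Sum>j<n. \<Sum>k<n. if j = k then p j else 0)"
    by (intro sum_mono) (auto simp: prob_record_event prob_record_event_Int p_def)
  also have "\<dots> = harm n"
    by (simp add: harm)
  finally show "expectation (\<lambda>\<omega>. (real (card (upper_record_indices (\<lambda>i. X i \<omega>) \<inter> {..<n})) - harm n)\<^sup>2) \<le> harm n" .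
qed

lemma prob_record_count_deviation:
  assumes "0 < d"
  shows "prob {\<omega>\<in>space M. d \<le> \<bar>real (card (upper_record_indices (\<lambda>i. X i \<omega>) \<inter> {..<n})) - harm n\<bar>}
    \<le> harm n / d\<^sup>2"
proof -
  have "prob {\<omega>\<in>space M. d \<le> \<bar>real (card (upper_record_indices (\<lambda>i. X i \<omega>) \<inter> {..<n})) - harm n\<bar>}
    \<le> expectation (\<lambda>\<omega>. (real (card (upper_record_indices (\<lambda>i. X i \<omega>) \<inter> {..<n})) - harm n)\<^sup>2) / d\<^sup>2"
    using assms expectation_record_count_deviation(1) by (intro second_moment_method) auto
  also have "\<dots> \<le> harm n / d\<^sup>2"
    by (intro divide_right_mono expectation_record_count_deviation(2)) simp
  finally show ?thesis .
qed

end

subsection \<open>Record values of an exponential family\<close>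

text \<open>The difference of the harmonic number and the logarithm decreases from its value 1 at
  \<open>n = 1\<close>.\<close>

lemma harm_le_ln:
  assumes "0 < n"
  shows "harm n \<le> 1 + ln (real n)"
proof -
  obtain k where "n = Suc k"
    using assms gr0_implies_Suc by blast
  then show ?thesis
    using decseqD[OF decseq_harm_diff_ln, of 0 k] by (simp add: harm_Suc harm_expand)
qed

context exp_family_first_type
begin

text \<open>Right continuity comes for free with any distribution function, so left limits are all
  that continuity still requires. The delicate point is a finite \<open>b\<close>.\<close>

lemma exp_family_cdf_at_left:
  assumes "\<theta> \<in> \<Theta>"
  shows "(exp_family_cdf a b A B \<theta> \<longlongrightarrow> exp_family_cdf a b A B \<theta> x) (at_left x)"
proof -
  let ?F = "exp_family_cdf a b A B \<theta>"
  consider "x \<le> a" | "a < x" "ereal x < b" | "b = ereal x" | "b < ereal x"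
    by (meson linorder_cases not_le)
  then show ?thesis
  proof cases
    case 1
    then have "?F x = 0"
      using support_nonempty A_left by (auto simp: exp_family_cdf_def)
    moreover have "eventually (\<lambda>y. ?F y = 0) (at_left x)"
      using 1 by (auto simp: eventually_at_filter exp_family_cdf_def)
    ultimately show ?thesis
      using tendsto_eventually by fastforce
  next
    case 2
    have "ereal y < b" if "y \<le> x" for y
      using le_less_trans[of "ereal y" "ereal x" b] that 2 by simp
    then have "continuous_on {a..x} A"
      by (intro continuous_on_subset[OF A_continuous]) auto
    then have "(A \<longlongrightarrow> A x) (at_left x)"
      using continuous_on_Icc_at_leftD 2 by blast
    then have "((\<lambda>y. 1 - exp (- (B \<theta> * A y))) \<longlongrightarrow> 1 - exp (- (B \<theta> * A x))) (at_left x)"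
      by (intro tendsto_intros)
    moreover have "eventually (\<lambda>y. ?F y = 1 - exp (- (B \<theta> * A y))) (at_left x)"
      using 2 \<open>\<And>y. y \<le> x \<Longrightarrow> ereal y < b\<close>
      by (intro eventually_at_leftI[of a]) (auto simp: exp_family_cdf_def)
    ultimately show ?thesis
      using 2 by (subst tendsto_cong) (auto simp: exp_family_cdf_def)
  next
    case 3
    then have "a < x"
      using support_nonempty by simp
    \<comment> \<open>Divergence of \<open>A\<close> at the right end excludes an atom at
      \<open>b\<close>.\<close>
    have "filterlim A at_top (at_left x)"
      using A_right 3 by (simp add: at_left_ereal filterlim_filtermap)
    then have "filterlim (\<lambda>y. B \<theta> * A y) at_top (at_left x)"
      using B_pos[OF assms] by (intro filterlim_tendsto_pos_mult_at_top[OF tendsto_const])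
    then have "((\<lambda>y. exp (- (B \<theta> * A y))) \<longlongrightarrow> 0) (at_left x)"
      by (intro filterlim_compose[OF exp_at_bot] filterlim_compose[OF filterlim_uminus_at_bot_at_top])
    then have "((\<lambda>y. 1 - exp (- (B \<theta> * A y))) \<longlongrightarrow> 1 - 0) (at_left x)"
      by (intro tendsto_intros)
    moreover have "eventually (\<lambda>y. ?F y = 1 - exp (- (B \<theta> * A y))) (at_left x)"
      using 3 \<open>a < x\<close>
      by (intro eventually_at_leftI[of a]) (auto simp: exp_family_cdf_def)
    ultimately show ?thesis
      using 3 \<open>a < x\<close> by (subst tendsto_cong) (auto simp: exp_family_cdf_def)
  next
    case 4
    then obtain r where r: "b = ereal r" "r < x" "a < r"
      using support_nonempty by (cases b) auto
    then have "eventually (\<lambda>y. ?F y = 1) (at_left x)"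
      by (intro eventually_at_leftI[of r]) (auto simp: exp_family_cdf_def)
    moreover have "?F x = 1"
      using r by (auto simp: exp_family_cdf_def)
    ultimately show ?thesis
      using tendsto_eventually by fastforce
  qed
qed

end

locale exp_family_sample = exp_family_first_type a b A \<Theta> B + prob_space M
  for a b A \<Theta> B and M :: "'w measure" +
  fixes \<theta> :: real and X :: "nat \<Rightarrow> 'w \<Rightarrow> real"
  assumes true_parameter: "\<theta> \<in> \<Theta>"
    and sample: "iid_sample M (exp_family_cdf a b A B \<theta>) X"
begin

sublocale iid_continuous M X "exp_family_cdf a b A B \<theta>"
proof
  show "indep_vars (\<lambda>_. borel) X UNIV"
    and cdf: "\<And>i. cdf (distr M borel (X i)) = exp_family_cdf a b A B \<theta>"
    using sample by (auto simp: iid_sample_def)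
  then have "X 0 \<in> borel_measurable M"
    by (auto simp: indep_vars_def)
  then interpret D: real_distribution "distr M borel (X 0)"
    by simp
  show "isCont (exp_family_cdf a b A B \<theta>) x" for x
    using D.cdf_is_right_cont[of x] exp_family_cdf_at_left[OF true_parameter, of x]
    by (auto simp: cdf continuous_within isCont_def filterlim_at_split)
qed

declare A_measurable [measurable]

lemma B_theta_pos: "0 < B \<theta>"
  by (rule B_pos[OF true_parameter])

text \<open>Off the support \<open>A\<close> is an arbitrary measurable function, so any passage
  from \<open>X i\<close> to \<open>A (X i)\<close> is made on this event.\<close>

lemma AE_support: "AE \<omega> in M. a \<le> X i \<omega> \<and> ereal (X i \<omega>) < b"
proof -
  have "prob {\<omega>\<in>space M. X i \<omega> \<le> a} = 0"
    using support_nonempty A_left by (simp add: prob_X_le exp_family_cdf_def)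
  then have 1: "AE \<omega> in M. \<not> X i \<omega> \<le> a"
    by (subst AE_iff_measurable[OF _ refl]) (auto simp: emeasure_eq_measure)
  have 2: "AE \<omega> in M. ereal (X i \<omega>) < b"
  proof (cases b)
    case (real r)
    have "prob {\<omega>\<in>space M. X i \<omega> < r} = measure (distr M borel (X i)) {..<r}"
      by (simp add: measure_distr vimage_def Int_def conj_commute)
    also have "\<dots> = 1"
      using real support_nonempty by (simp add: measure_distr_X_less exp_family_cdf_def)
    finally have "AE \<omega> in M. X i \<omega> < r"
      by (subst (asm) prob_Collect_eq_1) auto
    then show ?thesis
      using real by simp
  qed (use support_nonempty in auto)
  from 1 2 show ?thesis
    by eventually_elim auto
qed

text \<open>On the support both conditions on \<open>X i\<close> compare the same exponential, so
  the transform lemma yields the standard exponential law without inverting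
  \<open>A\<close>.\<close>

lemma prob_A_le:
  assumes "0 < c"
  shows "prob {\<omega>\<in>space M. B \<theta> * A (X i \<omega>) \<le> c} = 1 - exp (- c)"
proof -
  let ?F = "exp_family_cdf a b A B \<theta>"
  have "prob {\<omega>\<in>space M. B \<theta> * A (X i \<omega>) \<le> c} = prob {\<omega>\<in>space M. ?F (X i \<omega>) \<le> 1 - exp (- c)}"
  proof (rule finite_measure_eq_AE)
    show "AE \<omega> in M. \<omega> \<in> {\<omega>\<in>space M. B \<theta> * A (X i \<omega>) \<le> c} \<longleftrightarrow>
      \<omega> \<in> {\<omega>\<in>space M. ?F (X i \<omega>) \<le> 1 - exp (- c)}"
      using AE_support[of i] by eventually_elim (auto simp: exp_family_cdf_def)
  qed measurable
  also have "\<dots> = measure (distr M borel (X i)) {x. ?F x \<le> 1 - exp (- c)}"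
    by (simp add: measure_distr vimage_def Int_def conj_commute)
  also have "\<dots> = 1 - exp (- c)"
    using real_distribution.prob_cdf_le[OF real_distribution_X[of i], of "1 - exp (- c)"] assms F_cont
    by (simp add: cdf_X)
  finally show ?thesis .
qed

lemma prob_A_all_le:
  assumes "0 < c"
  shows "prob {\<omega>\<in>space M. \<forall>i<n. B \<theta> * A (X i \<omega>) \<le> c} = (1 - exp (- c)) ^ n"
\<comment> \<open>The product rule for independent events is applied over a nonempty index
  set.\<close>
proof (cases "n = 0")
  case False
  have "prob {\<omega>\<in>space M. \<forall>i<n. B \<theta> * A (X i \<omega>) \<le> c}
    = prob (\<Inter>i\<in>{..<n}. X i -` {x. B \<theta> * A x \<le> c} \<inter> space M)"
    using False by (intro arg_cong[where f=prob]) auto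
  also have "\<dots> = (\<Prod>i\<in>{..<n}. prob (X i -` {x. B \<theta> * A x \<le> c} \<inter> space M))"
    using False by (intro indep_varsD[OF indep]) auto
  also have "\<dots> = (\<Prod>i\<in>{..<n}. 1 - exp (- c))"
    using prob_A_le[OF assms] by (intro prod.cong) (simp_all add: vimage_def Int_def conj_commute)
  finally show ?thesis
    by simp
qed (simp add: prob_space)

lemma prob_A_all_le_bound:
  assumes "0 < c"
  shows "prob {\<omega>\<in>space M. \<forall>i<n. B \<theta> * A (X i \<omega>) \<le> c} \<le> exp (- (real n * exp (- c)))"
proof -
  have "(1 - exp (- c)) ^ n \<le> exp (- exp (- c)) ^ n"
    using assms exp_ge_add_one_self[of "- exp (- c)"] by (intro power_mono) auto
  also have "\<dots> = exp (- (real n * exp (- c)))"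
    by (simp add: exp_of_nat_mult[symmetric])
  finally show ?thesis
    using assms by (simp add: prob_A_all_le)
qed

lemma prob_A_ex_greater_bound:
  assumes "0 < c"
  shows "prob {\<omega>\<in>space M. \<exists>i<n. c < B \<theta> * A (X i \<omega>)} \<le> real n * exp (- c)"
proof -
  have "prob {\<omega>\<in>space M. \<exists>i<n. c < B \<theta> * A (X i \<omega>)}
    = prob (space M - {\<omega>\<in>space M. \<forall>i<n. B \<theta> * A (X i \<omega>) \<le> c})"
    by (intro arg_cong[where f=prob]) (auto simp: not_less not_le)
  also have "\<dots> = 1 - (1 - exp (- c)) ^ n"
    using assms by (subst prob_compl) (auto simp: prob_A_all_le)
  also have "\<dots> \<le> real n * exp (- c)"
    using Bernoulli_inequality[of "- exp (- c)" n] assms by simp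
  finally show ?thesis .
qed

lemma prob_record_value_deviation:
  assumes \<epsilon>: "0 < \<epsilon>" "\<epsilon> < 1 / 2" and m: "1 < \<epsilon> * real m"
  shows "prob {\<omega>\<in>space M. 2 * \<epsilon> < \<bar>B \<theta> * A (upper_record_value (\<lambda>i. X i \<omega>) m) / real m - 1\<bar>}
    \<le> (1 + (1 - \<epsilon>) * m) / (\<epsilon> * m - 1)\<^sup>2 + (1 + (1 + \<epsilon>) * m) / (\<epsilon> * m)\<^sup>2
      + exp (1 - exp (\<epsilon> * m)) + exp (- (\<epsilon> * m))"
proof -
  \<comment> \<open>The harmonic numbers of \<open>n1\<close> and \<open>n2\<close> are about
    \<open>(1 - \<epsilon>) * m\<close> and \<open>(1 + \<epsilon>) * m\<close>, so \<open>m\<close>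
    records are too many for the first range and too few for the second to stay below.\<close>
  define n1 where "n1 = nat \<lfloor>exp ((1 - \<epsilon>) * m)\<rfloor>"
  define n2 where "n2 = nat \<lfloor>exp ((1 + \<epsilon>) * m)\<rfloor>"
  \<comment> \<open>With these thresholds the expected number of exceedances is about
    \<open>exp (\<epsilon> * m)\<close> above \<open>t1\<close> in the first range and at most
    \<open>exp (- (\<epsilon> * m))\<close> above \<open>t2\<close> in the second.
    \<open>\<epsilon> < 1 / 2\<close> keeps \<open>t1\<close> positive.\<close>
  define t1 where "t1 = (1 - 2 * \<epsilon>) * m"
  define t2 where "t2 = (1 + 2 * \<epsilon>) * m"
  let ?N = "\<lambda>n \<omega>. card (upper_record_indices (\<lambda>i. X i \<omega>) \<inter> {..<n})"
  let ?R = "\<lambda>\<omega>. upper_record_value (\<lambda>i. X i \<omega>) m"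
  have m0: "0 < real m"
    using \<epsilon> m by (metis mult_not_zero not_one_less_zero of_nat_0_less_iff neq0_conv of_nat_0)
  have t: "0 < t1" "0 < t2"
    using \<epsilon> m0 by (auto simp: t1_def t2_def)
  have n1: "real n1 \<le> exp ((1 - \<epsilon>) * m)" "exp ((1 - \<epsilon>) * m) \<le> real n1 + 1"
    unfolding n1_def by (auto simp: of_nat_nat le_nat_floor)
  have n2: "real n2 \<le> exp ((1 + \<epsilon>) * m)" "exp ((1 + \<epsilon>) * m) \<le> real n2 + 1"
    unfolding n2_def by (auto simp: of_nat_nat le_nat_floor)
  have pos: "0 < n1" "0 < n2"
    using \<epsilon> m0 by (auto simp: n1_def n2_def)
  have harm1: "harm n1 \<le> 1 + (1 - \<epsilon>) * m"
    using harm_le_ln[OF pos(1)] ln_mono[OF n1(1)] pos by simp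
  \<comment> \<open>The lower bound uses \<open>ln (n2 + 1) <= harm n2\<close>, which absorbs the
    rounding of \<open>n2\<close>. The upper estimate for \<open>n1\<close> costs an additive 1,
    hence \<open>\<epsilon> * m - 1\<close> for \<open>E1\<close> but \<open>\<epsilon> * m\<close>
    for \<open>E2\<close>.\<close>
  have harm2: "harm n2 \<le> 1 + (1 + \<epsilon>) * m" "(1 + \<epsilon>) * m \<le> harm n2"
    using harm_le_ln[OF pos(2)] ln_mono[OF n2(1)] pos ln_mono[OF n2(2)] ln_le_harm[of n2] by simp_all
  define E1 where "E1 = {\<omega>\<in>space M. real m \<le> real (?N n1 \<omega>)}"
  define E2 where "E2 = {\<omega>\<in>space M. real (?N n2 \<omega>) < real m}"
  define E3 where "E3 = {\<omega>\<in>space M. \<forall>i<n1. B \<theta> * A (X i \<omega>) \<le> t1}"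
  define E4 where "E4 = {\<omega>\<in>space M. \<exists>i<n2. t2 < B \<theta> * A (X i \<omega>)}"
  note E_defs = E1_def E2_def E3_def E4_def
  have [measurable]: "E1 \<in> events" "E2 \<in> events" "E3 \<in> events" "E4 \<in> events"
    unfolding E_defs by measurable
  have "prob E1 \<le> prob {\<omega>\<in>space M. \<epsilon> * m - 1 \<le> \<bar>real (?N n1 \<omega>) - harm n1\<bar>}"
    unfolding E1_def using harm1 by (intro finite_measure_mono) (auto simp: algebra_simps)
  also have "\<dots> \<le> harm n1 / (\<epsilon> * m - 1)\<^sup>2"
    using m by (intro prob_record_count_deviation) simp
  also have "\<dots> \<le> (1 + (1 - \<epsilon>) * m) / (\<epsilon> * m - 1)\<^sup>2"
    by (intro divide_right_mono harm1) simp
  finally have P1: "prob E1 \<le> (1 + (1 - \<epsilon>) * m) / (\<epsilon> * m - 1)\<^sup>2" .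
  have "prob E2 \<le> prob {\<omega>\<in>space M. \<epsilon> * m \<le> \<bar>real (?N n2 \<omega>) - harm n2\<bar>}"
    unfolding E2_def using harm2 by (intro finite_measure_mono) (auto simp: algebra_simps)
  also have "\<dots> \<le> harm n2 / (\<epsilon> * m)\<^sup>2"
    using m by (intro prob_record_count_deviation) simp
  also have "\<dots> \<le> (1 + (1 + \<epsilon>) * m) / (\<epsilon> * m)\<^sup>2"
    by (intro divide_right_mono harm2) simp
  finally have P2: "prob E2 \<le> (1 + (1 + \<epsilon>) * m) / (\<epsilon> * m)\<^sup>2" .
  \<comment> \<open>Rounding down \<open>n1\<close> loses at most \<open>exp (- t1)\<close>, which
    is below 1; this is the 1 in the doubly exponential bound.\<close>
  have "exp (\<epsilon> * m) - 1 \<le> exp ((1 - \<epsilon>) * m) * exp (- t1) - exp (- t1)"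
    using t by (simp add: t1_def exp_add[symmetric] algebra_simps)
  also have "\<dots> = (exp ((1 - \<epsilon>) * m) - 1) * exp (- t1)"
    by (simp add: algebra_simps)
  also have "\<dots> \<le> real n1 * exp (- t1)"
    using n1 by (intro mult_right_mono) auto
  finally have P3: "prob E3 \<le> exp (1 - exp (\<epsilon> * m))"
    using prob_A_all_le_bound[OF t(1), of n1] unfolding E3_def
    by (elim order_trans) simp
  have "prob E4 \<le> real n2 * exp (- t2)"
    unfolding E4_def by (rule prob_A_ex_greater_bound[OF t(2)])
  also have "\<dots> \<le> exp ((1 + \<epsilon>) * m) * exp (- t2)"
    using n2 by (intro mult_right_mono) auto
  also have "\<dots> = exp (- (\<epsilon> * m))"
    by (simp add: t2_def exp_add[symmetric] algebra_simps)
  finally have P4: "prob E4 \<le> exp (- (\<epsilon> * m))" .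
  have [measurable]: "?R \<in> borel_measurable M"
    by (intro measurable_upper_record_value) simp
  \<comment> \<open>The record time is random, so one null set has to serve all indices.\<close>
  have "AE \<omega> in M. \<forall>i. a \<le> X i \<omega> \<and> ereal (X i \<omega>) < b"
    using AE_support by (simp add: AE_all_countable)
  then have "AE \<omega> in M. \<omega> \<in> {\<omega>\<in>space M. 2 * \<epsilon> < \<bar>B \<theta> * A (?R \<omega>) / real m - 1\<bar>}
    \<longrightarrow> \<omega> \<in> E1 \<union> E2 \<union> E3 \<union> E4"
  proof eventually_elim
    case (elim \<omega>)
    show ?case
    proof (rule impI, rule ccontr)
      assume dev: "\<omega> \<in> {\<omega>\<in>space M. 2 * \<epsilon> < \<bar>B \<theta> * A (?R \<omega>) / real m - 1\<bar>}"
        and "\<omega> \<notin> E1 \<union> E2 \<union> E3 \<union> E4"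
      then have cnt: "?N n1 \<omega> < m" "m \<le> ?N n2 \<omega>"
        and low: "\<exists>i<n1. t1 < B \<theta> * A (X i \<omega>)"
        and high: "\<And>i. i < n2 \<Longrightarrow> B \<theta> * A (X i \<omega>) \<le> t2"
        by (auto simp: E_defs not_less not_le) (meson not_le)
      obtain k where k: "k < n2" "?R \<omega> = X k \<omega>" "\<And>i. i < n1 \<Longrightarrow> X i \<omega> \<le> X k \<omega>"
        using upper_record_value_bracket[OF cnt] by blast
      from low obtain i where i: "i < n1" "t1 < B \<theta> * A (X i \<omega>)"
        by blast
      have "A (X i \<omega>) \<le> A (X k \<omega>)"
        using k(3)[OF i(1)] elim by (intro mono_onD[OF A_mono]) auto
      then have "B \<theta> * A (X i \<omega>) \<le> B \<theta> * A (X k \<omega>)"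
        using B_theta_pos by simp
      then have "(1 - 2 * \<epsilon>) * m \<le> B \<theta> * A (?R \<omega>)" "B \<theta> * A (?R \<omega>) \<le> (1 + 2 * \<epsilon>) * m"
        using i high[OF k(1)] k(2) by (auto simp: t1_def t2_def)
      then have "1 - 2 * \<epsilon> \<le> B \<theta> * A (?R \<omega>) / m" "B \<theta> * A (?R \<omega>) / m \<le> 1 + 2 * \<epsilon>"
        using m0 by (simp_all add: pos_le_divide_eq pos_divide_le_eq)
      with dev show False
        by (auto simp: abs_if split: if_splits)
    qed
  qed
  then have "prob {\<omega>\<in>space M. 2 * \<epsilon> < \<bar>B \<theta> * A (?R \<omega>) / real m - 1\<bar>} \<le> prob (E1 \<union> E2 \<union> E3 \<union> E4)"
    by (intro finite_measure_mono_AE) auto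
  also have "\<dots> \<le> prob E1 + prob E2 + prob E3 + prob E4"
    by (intro order_trans[OF measure_Un_le] add_mono order_refl) auto
  finally show ?thesis
    using P1 P2 P3 P4 by linarith
qed

lemma record_value_deviation_tendsto:
  assumes "0 < e"
  shows "(\<lambda>m. prob {\<omega>\<in>space M. e < \<bar>B \<theta> * A (upper_record_value (\<lambda>i. X i \<omega>) m) / real m - 1\<bar>}) \<longlonglongrightarrow> 0"
proof -
  \<comment> \<open>The cap \<open>1 / 4\<close> keeps \<open>\<epsilon>\<close> below
    \<open>1 / 2\<close>; shrinking the deviation only enlarges the event.\<close>
  define \<epsilon> where "\<epsilon> = min (e / 2) (1 / 4)"
  have \<epsilon>: "0 < \<epsilon>" "\<epsilon> < 1 / 2" "2 * \<epsilon> \<le> e"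
    using assms by (auto simp: \<epsilon>_def)
  have [measurable]: "(\<lambda>\<omega>. upper_record_value (\<lambda>i. X i \<omega>) m) \<in> borel_measurable M" for m
    by (intro measurable_upper_record_value) simp
  show ?thesis
  proof (rule tendsto_sandwich[OF _ _ tendsto_const])
    show "eventually (\<lambda>m. prob {\<omega>\<in>space M. e < \<bar>B \<theta> * A (upper_record_value (\<lambda>i. X i \<omega>) m) / real m - 1\<bar>}
      \<le> (1 + (1 - \<epsilon>) * m) / (\<epsilon> * m - 1)\<^sup>2 + (1 + (1 + \<epsilon>) * m) / (\<epsilon> * m)\<^sup>2
      + exp (1 - exp (\<epsilon> * m)) + exp (- (\<epsilon> * m))) sequentially"
    proof -
      have "eventually (\<lambda>m. 1 < \<epsilon> * real m) sequentially"
        using \<epsilon>(1) by real_asymp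
      then show ?thesis
      proof eventually_elim
        case (elim m)
        have "prob {\<omega>\<in>space M. e < \<bar>B \<theta> * A (upper_record_value (\<lambda>i. X i \<omega>) m) / real m - 1\<bar>}
          \<le> prob {\<omega>\<in>space M. 2 * \<epsilon> < \<bar>B \<theta> * A (upper_record_value (\<lambda>i. X i \<omega>) m) / real m - 1\<bar>}"
          using \<epsilon>(3) by (intro finite_measure_mono) auto
        also note prob_record_value_deviation[OF \<epsilon>(1,2) elim]
        finally show ?case .
      qed
    qed
    show "(\<lambda>m. (1 + (1 - \<epsilon>) * m) / (\<epsilon> * m - 1)\<^sup>2 + (1 + (1 + \<epsilon>) * m) / (\<epsilon> * m)\<^sup>2
      + exp (1 - exp (\<epsilon> * m)) + exp (- (\<epsilon> * m))) \<longlonglongrightarrow> 0"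
      using \<epsilon>(1,2) by real_asymp
  qed simp
qed

end

subsection \<open>Inverting the parametrisation\<close>

context exp_family_first_type
begin

lemma B_continuous: "continuous_on \<Theta> B"
  using B_twice_differentiable unfolding twice_differentiable_on_def by (blast intro: DERIV_continuous_on)

text \<open>The derivative of \<open>B\<close> may vanish, so the argument is topological: a
  continuous injection of an interval is a homeomorphism onto its image.\<close>

lemma the_inv_into_B_continuous: "continuous_on (B ` \<Theta>) (the_inv_into \<Theta> B)"
proof -
  have "path_connected \<Theta>"
    using interval is_interval_path_connected by blast
  then obtain g where g: "homeomorphism \<Theta> (B ` \<Theta>) B g"
    using injective_into_1d_eq_homeomorphism B_continuous B_inj by blast
  have "g y = the_inv_into \<Theta> B y" if "y \<in> B ` \<Theta>" for y
    using that g B_inj by (auto simp: the_inv_into_f_f homeomorphism_def)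
  then show ?thesis
    using homeomorphism_cont2[OF g] by (simp cong: continuous_on_cong)
qed

text \<open>Outside \<open>B ` \<Theta>\<close> the definite description in \<^const>\<open>the_inv_into\<close> is over the empty
  predicate, hence constant.\<close>

lemma the_inv_into_B_measurable: "the_inv_into \<Theta> B \<in> borel_measurable borel"
proof -
  have "is_interval (B ` \<Theta>)"
    using interval B_continuous by (simp add: is_interval_connected_1 connected_continuous_image)
  then have "B ` \<Theta> \<in> sets borel"
    by (rule real_interval_borel_measurable)
  then have "(\<lambda>y. if y \<in> B ` \<Theta> then the_inv_into \<Theta> B y else (THE t. False)) \<in> borel_measurable borel"
    by (intro borel_measurable_continuous_on_if the_inv_into_B_continuous continuous_on_const)
  moreover have "(\<lambda>y. if y \<in> B ` \<Theta> then the_inv_into \<Theta> B y else (THE t. False)) = the_inv_into \<Theta> B"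
  proof
    fix y
    show "(if y \<in> B ` \<Theta> then the_inv_into \<Theta> B y else (THE t. False)) = the_inv_into \<Theta> B y"
    proof (cases "y \<in> B ` \<Theta>")
      case False
      then have "(\<lambda>t. t \<in> \<Theta> \<and> B t = y) = (\<lambda>t. False)"
        by auto
      with False show ?thesis
        by (simp add: the_inv_into_def)
    qed simp
  qed
  ultimately show ?thesis
    by simp
qed

lemma the_inv_into_B_near:
  assumes "\<theta> \<in> \<Theta>" "0 < \<epsilon>"
  obtains e where "0 < e"
    and "\<And>r. \<bar>r - 1\<bar> \<le> e \<Longrightarrow> B \<theta> / r \<in> B ` \<Theta> \<Longrightarrow> \<bar>the_inv_into \<Theta> B (B \<theta> / r) - \<theta>\<bar> \<le> \<epsilon>"
proof -
  have "the_inv_into \<Theta> B (B \<theta>) = \<theta>"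
    using B_inj assms by (simp add: the_inv_into_f_f)
  then obtain d where d: "0 < d"
    "\<And>y. y \<in> B ` \<Theta> \<Longrightarrow> dist y (B \<theta>) < d \<Longrightarrow> dist (the_inv_into \<Theta> B y) \<theta> < \<epsilon>"
    using the_inv_into_B_continuous assms unfolding continuous_on_iff by (metis imageI)
  have "((\<lambda>r. B \<theta> / r) \<longlongrightarrow> B \<theta> / 1) (nhds 1)"
    by (intro tendsto_intros filterlim_ident) auto
  then have "eventually (\<lambda>r. dist (B \<theta> / r) (B \<theta>) < d) (nhds 1)"
    using d(1) by (auto dest: tendstoD)
  then obtain e where e: "0 < e" "\<And>r. dist r 1 < e \<Longrightarrow> dist (B \<theta> / r) (B \<theta>) < d"
    by (auto simp: eventually_nhds_metric)
  show ?thesis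
  \<comment> \<open>Halving turns the strict radius into the closed one, so that its complement is
    the strict deviation event bounded before.\<close>
  proof (rule that[of "e / 2"])
    fix r assume "\<bar>r - 1\<bar> \<le> e / 2" "B \<theta> / r \<in> B ` \<Theta>"
    then have "dist (the_inv_into \<Theta> B (B \<theta> / r)) \<theta> < \<epsilon>"
      using e by (intro d(2)) (auto simp: dist_real_def)
    then show "\<bar>the_inv_into \<Theta> B (B \<theta> / r) - \<theta>\<bar> \<le> \<epsilon>"
      by (simp add: dist_real_def)
  qed (use e in simp)
qed

end

theorem theorem7:
  fixes a :: real and b :: ereal and A :: "real \<Rightarrow> real"
    and \<Theta> :: "real set" and B :: "real \<Rightarrow> real" and \<theta> :: real
    and M :: "'w measure" and X :: "nat \<Rightarrow> 'w \<Rightarrow> real"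
  assumes family: "exp_family_first_type a b A \<Theta> B"
    and true_parameter: "\<theta> \<in> \<Theta>"
    and prob: "prob_space M"
    and sample: "iid_sample M (exp_family_cdf a b A B \<theta>) X"
    and B_inverse_defined: "\<And>m. m \<ge> 1 \<Longrightarrow>
      AE \<omega> in M. real m / A (upper_record_value (\<lambda>i. X i \<omega>) m) \<in> B ` \<Theta>"
  shows "converges_in_probability M (\<lambda>m \<omega>. record_mle A \<Theta> B (\<lambda>i. X i \<omega>) m) \<theta>"
proof -
  interpret exp_family_sample a b A \<Theta> B M \<theta> X
    using assms by (simp add: exp_family_sample_def exp_family_sample_axioms_def)
  let ?R = "\<lambda>m \<omega>. upper_record_value (\<lambda>i. X i \<omega>) m"
  have [measurable]: "?R m \<in> borel_measurable M" for m
    by (intro measurable_upper_record_value) simp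
  note [measurable] = the_inv_into_B_measurable
  have mle [measurable]: "(\<lambda>\<omega>. record_mle A \<Theta> B (\<lambda>i. X i \<omega>) m) \<in> borel_measurable M" for m
    unfolding record_mle_def by measurable
  have "(\<lambda>m. measure M {\<omega>\<in>space M. \<bar>record_mle A \<Theta> B (\<lambda>i. X i \<omega>) m - \<theta>\<bar> > \<epsilon>}) \<longlonglongrightarrow> 0"
    if \<epsilon>: "0 < \<epsilon>" for \<epsilon>
  proof -
    obtain e where e: "0 < e"
      "\<And>r. \<bar>r - 1\<bar> \<le> e \<Longrightarrow> B \<theta> / r \<in> B ` \<Theta> \<Longrightarrow> \<bar>the_inv_into \<Theta> B (B \<theta> / r) - \<theta>\<bar> \<le> \<epsilon>"
      using the_inv_into_B_near[OF true_parameter \<epsilon>] by blast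
    have "eventually (\<lambda>m. measure M {\<omega>\<in>space M. \<bar>record_mle A \<Theta> B (\<lambda>i. X i \<omega>) m - \<theta>\<bar> > \<epsilon>}
      \<le> measure M {\<omega>\<in>space M. e < \<bar>B \<theta> * A (?R m \<omega>) / real m - 1\<bar>}) sequentially"
      \<comment> \<open>The inverse is assumed to be defined only for \<open>m >= 1\<close>, and
        only almost surely, so the inclusion of events below holds up to a null set.\<close>
      using eventually_ge_at_top[of 1]
    proof eventually_elim
      case (elim m)
      show ?case
      proof (rule finite_measure_mono_AE)
        show "AE \<omega> in M. \<omega> \<in> {\<omega>\<in>space M. \<bar>record_mle A \<Theta> B (\<lambda>i. X i \<omega>) m - \<theta>\<bar> > \<epsilon>} \<longrightarrow>
          \<omega> \<in> {\<omega>\<in>space M. e < \<bar>B \<theta> * A (?R m \<omega>) / real m - 1\<bar>}"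
          using B_inverse_defined[OF elim]
        proof eventually_elim
          case (elim \<omega>)
          \<comment> \<open>The unknown factor \<open>B \<theta>\<close> cancels; a vanishing
            \<open>A\<close> is consistent too, since both sides are then 0.\<close>
          have "B \<theta> / (B \<theta> * A (?R m \<omega>) / real m) = real m / A (?R m \<omega>)"
            using B_theta_pos by simp
          with e(2)[of "B \<theta> * A (?R m \<omega>) / real m"] elim
          have "\<bar>B \<theta> * A (?R m \<omega>) / real m - 1\<bar> \<le> e \<Longrightarrow> \<bar>record_mle A \<Theta> B (\<lambda>i. X i \<omega>) m - \<theta>\<bar> \<le> \<epsilon>"
            by (simp add: record_mle_def)
          then show ?case
            using not_le by blast
        qed
      qed measurable
    qed
    then show ?thesis
      by (intro tendsto_sandwich[OF _ _ tendsto_const record_value_deviation_tendsto[OF e(1)]]) auto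
  qed
  with mle show ?thesis
    by (simp add: converges_in_probability_def)
qed

end
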